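(* The threshold bias of the rainbow-spanning-tree game $\mathcal{RS}_n$ satisfies $$\left(\tfrac{\log(2)}{8}-o(1)\right)\frac{n^2}{\log(n)}\leq b_{\mathcal{RS}_n}\leq (1+o(1))\frac{n^2}{\log(n)}.$$
   Context: $\log$ is the natural logarithm and $o(1)$ denotes a quantity tending to $0$ as $n\to\infty$. A $(1:b)$ Maker-Breaker game on a finite board $X$ with a family of winning sets: Maker and Breaker alternately claim unclaimed elements of $X$, Maker $1$ per round and Breaker $b$ per round, until all are claimed; Maker wins if she claims all elements of some winning set, otherwise Breaker wins. The threshold bias is the unique integer $b_0$ such that Breaker wins the $(1:b)$ game iff $b\geq b_0$. The rainbow-spanning-tree game $\mathcal{RS}_n$ is played on the board $X=\bigcup_{i\in[n-1]}E(G_i)$, where $G_1,\dots,G_{n-1}$ are distinct copies of $K_n$ on the common vertex set $V=[n]$; Maker wins iff she claims a rainbow spanning tree, i.e., a spanning tree on $V$ containing exactly one edge of each $G_i$. *)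

theory Defs
  imports Complex_Main
begin

section \<open>Maker-Breaker games\<close>

text \<open>Positions are pairs (M, B) of the sets claimed so far by Maker and Breaker.
  maker_wins_from X F b M B: it is Maker's turn in position (M,B) and Maker has a
  strategy that guarantees she eventually claims all elements of some winning set.
  Each round Maker claims one free element, then Breaker claims b free elements
  (or all remaining free elements if fewer than b are left). The game ends when all
  elements of X are claimed.\<close>

inductive maker_wins_from :: "'a set \<Rightarrow> 'a set set \<Rightarrow> nat \<Rightarrow> 'a set \<Rightarrow> 'a set \<Rightarrow> bool"
  for X :: "'a set" and F :: "'a set set" and b :: nat where
  won: "W \<in> F \<Longrightarrow> W \<subseteq> M \<Longrightarrow> maker_wins_from X F b M B"
| move: "x \<in> X - (M \<union> B) \<Longrightarrow>
         (\<And>S. S \<subseteq> X - (M \<union> B) - {x} \<Longrightarrow> card S = min b (card (X - (M \<union> B) - {x})) \<Longrightarrow>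
               maker_wins_from X F b (insert x M) (B \<union> S)) \<Longrightarrow>
         maker_wins_from X F b M B"

text \<open>Maker (who moves first) wins the (1:b) game on board X with winning sets F.\<close>
definition maker_wins :: "'a set \<Rightarrow> 'a set set \<Rightarrow> nat \<Rightarrow> bool" where
  "maker_wins X F b \<longleftrightarrow> maker_wins_from X F b {} {}"

text \<open>Threshold bias: the least b for which Breaker wins (Breaker wins iff Maker does not).\<close>
definition threshold_bias :: "'a set \<Rightarrow> 'a set set \<Rightarrow> nat" where
  "threshold_bias X F = (LEAST b. \<not> maker_wins X F b)"

section \<open>Graphs on a vertex set, spanning trees\<close>

text \<open>Edges of the complete graph on V: 2-element subsets.\<close>
definition complete_edges :: "'v set \<Rightarrow> 'v set set" where
  "complete_edges V = {e. e \<subseteq> V \<and> card e = 2}"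

definition graph_connected :: "'v set \<Rightarrow> 'v set set \<Rightarrow> bool" where
  "graph_connected V E \<longleftrightarrow>
     (\<forall>u\<in>V. \<forall>v\<in>V. (u, v) \<in> {(x, y). {x, y} \<in> E}\<^sup>*)"

text \<open>A cycle: a list of at least 3 distinct vertices, consecutive ones adjacent,
  and the last adjacent to the first.\<close>
definition has_cycle :: "'v set set \<Rightarrow> bool" where
  "has_cycle E \<longleftrightarrow> (\<exists>vs. length vs \<ge> 3 \<and> distinct vs \<and>
      (\<forall>i. Suc i < length vs \<longrightarrow> {vs ! i, vs ! Suc i} \<in> E) \<and>
      {last vs, hd vs} \<in> E)"

definition is_spanning_tree :: "'v set \<Rightarrow> 'v set set \<Rightarrow> bool" where
  "is_spanning_tree V E \<longleftrightarrow>
     E \<subseteq> complete_edges V \<and> graph_connected V E \<and> \<not> has_cycle E"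

section \<open>The rainbow spanning tree game\<close>

text \<open>The board: edge e of the copy G_i of K_n on [n] is the pair (i, e), i in [n-1].\<close>
definition RS_board :: "nat \<Rightarrow> (nat \<times> nat set) set" where
  "RS_board n = {1..n-1} \<times> complete_edges {1..n}"

text \<open>Rainbow spanning trees: subsets T of the board whose underlying edges form a
  spanning tree on [n] (and no edge is used twice) and which contain exactly one edge
  of each G_i.\<close>
definition rainbow_spanning_trees :: "nat \<Rightarrow> (nat \<times> nat set) set set" where
  "rainbow_spanning_trees n = {T. T \<subseteq> RS_board n \<and>
      inj_on snd T \<and> is_spanning_tree {1..n} (snd ` T) \<and>
      (\<forall>i\<in>{1..n-1}. \<exists>!e. (i, e) \<in> T)}"

definition RS_threshold :: "nat \<Rightarrow> nat" where
  "RS_threshold n = threshold_bias (RS_board n) (rainbow_spanning_trees n)"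

end

theory Submission
  imports Defs "HOL-Analysis.Harmonic_Numbers" "HOL-Real_Asymp.Real_Asymp"
begin

text \<open>Upper bound: the \<open>n - 1\<close> colour classes are disjoint boxes of size \<open>n choose 2\<close>, so
  Breaker can claim all edges of one colour by playing the box game, and \<open>n\<^sup>2 / ln n\<close> exceeds
  the bias that this needs by a factor of about 2.

  Lower bound: by Rado's theorem for the graphic matroid, if Maker has no rainbow spanning tree
  then there are \<open>k\<close> colours and a partition of the vertices into at least \<open>n - k + 1\<close> parts
  such that she owns no crossing edge in these colours. If \<open>5k \<le> n\<close>, all but \<open>2k - 2\<close> vertices
  are singleton parts, and Maker has no edge in these colours at any of them. Otherwise, if some
  part has \<open>n - t > 2n/3\<close> vertices, then \<open>k \<ge> n - t\<close> and its complement of size \<open>t\<close> gives an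
  uncrossed cut; if not, some union of parts gives a balanced uncrossed cut. Maker hits all the
  corresponding edge sets by the Erdos--Selfridge--Beck potential strategy, because for bias
  \<open>ln 2 / 8 * n\<^sup>2 / ln n\<close> a set of \<open>s\<close> edges has weight \<open>n powr (- 8 s / n\<^sup>2)\<close> and
  the total weight is below 1.\<close>

section \<open>Rainbow bases\<close>

text \<open>A matroid presented by its closure operator; this form is convenient because the
  obstruction in Rado's theorem is a statement about spans.\<close>

locale exchange_closure =
  fixes cl :: "'a set \<Rightarrow> 'a set"
  assumes subset_cl: "A \<subseteq> cl A"
    and cl_mono: "A \<subseteq> B \<Longrightarrow> cl A \<subseteq> cl B"
    and cl_idem: "cl (cl A) \<subseteq> cl A"
    and exchange: "y \<in> cl (insert x A) \<Longrightarrow> y \<notin> cl A \<Longrightarrow> x \<in> cl (insert y A)"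
begin

definition indep :: "'a set \<Rightarrow> bool" where
  "indep T \<longleftrightarrow> (\<forall>x\<in>T. x \<notin> cl (T - {x}))"

lemma cl_least: "A \<subseteq> cl B \<Longrightarrow> cl A \<subseteq> cl B"
  using cl_mono cl_idem by blast

lemma indep_subset: "indep T \<Longrightarrow> S \<subseteq> T \<Longrightarrow> indep S"
  unfolding indep_def using cl_mono[of "S - {x}" "T - {x}" for x] by blast

lemma indep_insert:
  assumes "indep T" "x \<notin> cl T"
  shows "indep (insert x T)"
  unfolding indep_def
proof (intro ballI notI)
  fix y assume y: "y \<in> insert x T" "y \<in> cl (insert x T - {y})"
  have xT: "x \<notin> T" using assms(2) subset_cl by blast
  show False
  proof (cases "y = x")
    case True
    then show False using y(2) assms(2) xT by simp
  next
    case False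
    then have yT: "y \<in> T" using y(1) by simp
    have "y \<in> cl (insert x (T - {y}))" using y(2) False by (simp add: insert_Diff_if)
    moreover have "y \<notin> cl (T - {y})" using assms(1) yT unfolding indep_def by blast
    ultimately have "x \<in> cl (insert y (T - {y}))" by (rule exchange)
    then show False using assms(2) yT by (simp add: insert_absorb)
  qed
qed

lemma indep_exchange: "indep T \<Longrightarrow> e \<notin> cl (T - {f}) \<Longrightarrow> indep (insert e (T - {f}))"
  by (rule indep_insert) (auto intro: indep_subset)

text \<open>For \<open>e\<close> outside \<open>T\<close> the set on the right is the fundamental
  circuit of \<open>e\<close> in \<open>T\<close>, without \<open>e\<close>. A smallest
  \<open>D\<close> in \<open>T\<close> spanning \<open>e\<close> lies in it: if
  \<open>T - {f}\<close> spanned \<open>e\<close> for some \<open>f\<close> in \<open>D\<close>,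
  exchange would put \<open>f\<close> into the span of \<open>e\<close> and \<open>D - {f}\<close>,
  hence of \<open>T - {f}\<close>, against independence.\<close>

lemma in_cl_circuit:
  assumes "finite T" "indep T" "e \<in> cl T"
  shows "e \<in> cl {f\<in>T. e \<notin> cl (T - {f})}"
proof -
  let ?P = "\<lambda>D. D \<subseteq> T \<and> e \<in> cl D"
  have "?P T" using assms(3) by simp
  then obtain D where D: "D \<subseteq> T" "e \<in> cl D" and min: "\<And>D'. ?P D' \<Longrightarrow> card D \<le> card D'"
    using ex_has_least_nat[of ?P T card] by blast
  have "D \<subseteq> {f\<in>T. e \<notin> cl (T - {f})}"
  proof (intro subsetI CollectI conjI notI)
    fix f assume f: "f \<in> D"
    then show "f \<in> T" using D by blast
    assume e: "e \<in> cl (T - {f})"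
    have "finite D" using D(1) assms(1) finite_subset by blast
    then have "card (D - {f}) < card D" using f by (rule card_Diff1_less)
    then have "e \<notin> cl (D - {f})" using min[of "D - {f}"] D(1) by force
    moreover have "e \<in> cl (insert f (D - {f}))" using D(2) f by (simp add: insert_absorb)
    ultimately have "f \<in> cl (insert e (D - {f}))" by (rule exchange[rotated])
    also have "\<dots> \<subseteq> cl (T - {f})"
      using e D(1) subset_cl[of "T - {f}"] by (intro cl_least) blast
    finally show False using \<open>f \<in> T\<close> assms(2) unfolding indep_def by blast
  qed
  then show ?thesis using D(2) cl_mono by blast
qed

text \<open>Rado's theorem for colour classes. \<open>R\<close> consists of the colours missed by some
  rainbow independent set obtained from a fixed maximum one \<open>T0\<close> by successive exchanges. An
  exchange only swaps elements with colours in \<open>R\<close>, along a circuit with colours in \<open>R\<close>, so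
  the closure of the part with colours in \<open>R\<close> is the same for all these sets.\<close>

theorem rainbow_basis_or_obstruction:
  assumes "finite E" "finite K" "col ` E \<subseteq> K"
  shows "(\<exists>T\<subseteq>E. indep T \<and> inj_on col T \<and> col ` T = K) \<or>
    (\<exists>R D. R \<subseteq> K \<and> D \<subseteq> E \<and> card D < card R \<and> (\<forall>e\<in>E. col e \<in> R \<longrightarrow> e \<in> cl D))"
proof -
  define rb where "rb T \<longleftrightarrow> T \<subseteq> E \<and> indep T \<and> inj_on col T" for T
  have "rb {}" unfolding rb_def indep_def by simp
  moreover have "card T < Suc (card E)" if "rb T" for T
    using that assms(1) unfolding rb_def by (simp add: card_mono less_Suc_eq_le)
  ultimately obtain T0 where T0: "rb T0" and max: "\<And>T. rb T \<Longrightarrow> card T \<le> card T0"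
    using ex_has_greatest_nat[of rb "{}" card "Suc (card E)"] by blast
  have finT: "finite T" if "rb T" for T
    using that assms(1) finite_subset unfolding rb_def by blast
  have spanned: "e \<in> cl T" if "rb T" "card T = card T0" "e \<in> E" "col e \<notin> col ` T" for T e
  proof (rule ccontr)
    assume "e \<notin> cl T"
    then have "rb (insert e T)"
      using that indep_insert[of T e] unfolding rb_def by (auto simp: inj_on_insert)
    then have "card (insert e T) \<le> card T" using max that(2) by simp
    moreover have "e \<notin> T" using that(4) by blast
    ultimately show False using finT[OF that(1)] by simp
  qed
  \<comment> \<open>An exchange brings in an element of a missing colour and drops an element of its
    fundamental circuit, so the size is kept.\<close>
  define step where "step T T' \<longleftrightarrow> (\<exists>e\<in>E. \<exists>f\<in>T. col e \<notin> col ` T \<and> e \<in> cl T \<and>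
      e \<notin> cl (T - {f}) \<and> T' = insert e (T - {f}))" for T T'
  define R where "R = {c\<in>K. \<exists>T. step\<^sup>*\<^sup>* T0 T \<and> c \<notin> col ` T}"
  define res where "res T = {t\<in>T. col t \<in> R}" for T
  \<comment> \<open>Dropping any \<open>f\<close> on the circuit of \<open>e\<close> is a step after
    which the colour of \<open>f\<close> is missing, so all colours on the circuit lie in
    \<open>R\<close>.\<close>
  have in_res: "e \<in> cl (res T)"
    if "step\<^sup>*\<^sup>* T0 T" "rb T" "card T = card T0" "e \<in> E" "col e \<notin> col ` T" for T e
  proof -
    have eT: "e \<in> cl T" using spanned that by blast
    have "{f\<in>T. e \<notin> cl (T - {f})} \<subseteq> res T"
    proof
      fix f assume "f \<in> {f\<in>T. e \<notin> cl (T - {f})}"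
      then have f: "f \<in> T" "e \<notin> cl (T - {f})" by auto
      have "step T (insert e (T - {f}))" unfolding step_def using that f eT by blast
      then have "step\<^sup>*\<^sup>* T0 (insert e (T - {f}))" using that(1) by simp
      moreover have "col f \<notin> col ` insert e (T - {f})"
      proof -
        have "col f \<noteq> col e" using that(5) f(1) by (metis imageI)
        moreover have "col f \<noteq> col g" if "g \<in> T - {f}" for g
          using \<open>rb T\<close> that f(1) unfolding rb_def inj_on_def by blast
        ultimately show ?thesis by blast
      qed
      moreover have "col f \<in> K" using f(1) that(2) assms(3) unfolding rb_def by blast
      ultimately show "f \<in> res T" unfolding res_def R_def using f(1) by blast
    qed
    then show ?thesis
      using in_cl_circuit[OF finT[OF that(2)] _ eT] that(2) cl_mono unfolding rb_def by blast
  qed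
  have inv: "rb T \<and> card T = card T0 \<and> cl (res T) = cl (res T0)" if "step\<^sup>*\<^sup>* T0 T" for T
    using that
  proof (induction rule: rtranclp_induct)
    case base
    then show ?case using T0 by simp
  next
    case (step T T')
    then have T: "rb T" "card T = card T0" "cl (res T) = cl (res T0)" by auto
    obtain e f where ef: "e \<in> E" "f \<in> T" "col e \<notin> col ` T" "e \<in> cl T" "e \<notin> cl (T - {f})"
      and T': "T' = insert e (T - {f})"
      using step.hyps(2) unfolding step_def by blast
    have eT: "e \<notin> T" using ef(3) by blast
    have reach: "step\<^sup>*\<^sup>* T0 T'" using step.hyps by simp
    have "rb T'"
      using T(1) indep_exchange[of T e f] ef unfolding rb_def T'
      by (auto simp: inj_on_insert intro: inj_on_subset)
    moreover have "card T' = card T0"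
      using T(2) finT[OF T(1)] eT card.remove[OF finT[OF T(1)] ef(2)] unfolding T'
      by (simp del: card_Diff_insert)
    \<comment> \<open>The colours of \<open>e\<close> and \<open>f\<close> both lie in
      \<open>R\<close>, so \<open>res\<close> undergoes the same swap. Here \<open>e\<close> is
      spanned by \<open>res T\<close>, and by exchange \<open>f\<close> is spanned by
      \<open>res T'\<close>.\<close>
    moreover have "cl (res T') = cl (res T0)"
    proof -
      have "col e \<in> R" unfolding R_def using ef step.hyps(1) assms(3) by blast
      moreover have "col f \<notin> col ` T'"
      proof -
        have "col f \<noteq> col e" using ef(2,3) by (metis imageI)
        moreover have "col f \<noteq> col g" if "g \<in> T - {f}" for g
          using T(1) that ef(2) unfolding rb_def inj_on_def by blast
        ultimately show ?thesis unfolding T' by blast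
      qed
      then have fR: "col f \<in> R"
        unfolding R_def using ef T(1) reach assms(3) unfolding rb_def by blast
      ultimately have resT': "res T' = insert e (res T - {f})"
        unfolding res_def T' by auto
      have e_res: "e \<in> cl (res T)" using in_res step.hyps(1) T ef by blast
      have "f \<in> res T" using fR ef unfolding res_def by blast
      then have "e \<in> cl (insert f (res T - {f}))" using e_res by (simp add: insert_absorb)
      moreover have "e \<notin> cl (res T - {f})"
        using ef(5) cl_mono[of "res T - {f}" "T - {f}"] unfolding res_def by blast
      ultimately have "f \<in> cl (res T')" unfolding resT' by (rule exchange)
      then have "res T \<subseteq> cl (res T')" using subset_cl[of "res T'"] unfolding resT' by blast
      moreover have "res T' \<subseteq> cl (res T)"
        using subset_cl[of "res T"] e_res unfolding resT' by blast
      ultimately show ?thesis using cl_least T(3) by blast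
    qed
    ultimately show ?case by blast
  qed
  show ?thesis
  proof (cases "col ` T0 = K")
    case True
    then show ?thesis using T0 unfolding rb_def by blast
  next
    case False
    then obtain c0 where c0: "c0 \<in> K" "c0 \<notin> col ` T0"
      using T0 assms(3) unfolding rb_def by blast
    have c0R: "c0 \<in> R" unfolding R_def using c0 by blast
    have finR: "finite R" unfolding R_def using assms(2) by simp
    \<comment> \<open>The spanning set \<open>D\<close> is \<open>res T0\<close>: its elements have
      distinct colours in \<open>R\<close>, all different from \<open>c0\<close>.\<close>
    have "card (res T0) = card (col ` res T0)"
      using T0 unfolding rb_def res_def by (intro card_image[symmetric]) (auto simp: inj_on_def)
    also have "col ` res T0 \<subseteq> R - {c0}" unfolding res_def using c0 by auto
    then have "card (col ` res T0) \<le> card (R - {c0})" using finR by (intro card_mono) auto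
    also have "\<dots> < card R" using finR c0R by (rule card_Diff1_less)
    finally have "card (res T0) < card R" .
    \<comment> \<open>Pass to a reachable set that misses the colour of \<open>e\<close>; the span
      of its \<open>res\<close> is the same.\<close>
    moreover have "e \<in> cl (res T0)" if e: "e \<in> E" "col e \<in> R" for e
    proof -
      obtain T where T: "step\<^sup>*\<^sup>* T0 T" "col e \<notin> col ` T" using e(2) unfolding R_def by blast
      then show ?thesis using in_res[of T e] inv[of T] e(1) by blast
    qed
    moreover have "R \<subseteq> K" unfolding R_def by blast
    moreover have "res T0 \<subseteq> E" using T0 unfolding rb_def res_def by blast
    ultimately show ?thesis by blast
  qed
qed

end

section \<open>Connectivity\<close>

definition conn :: "'v set set \<Rightarrow> ('v \<times> 'v) set" where
  "conn E = {(x, y). {x, y} \<in> E}\<^sup>*"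

lemma conn_refl [simp]: "(x, x) \<in> conn E"
  unfolding conn_def by simp

lemma conn_sym: "(x, y) \<in> conn E \<Longrightarrow> (y, x) \<in> conn E"
proof -
  have "sym ({(x, y). {x, y} \<in> E}\<^sup>*)" by (intro sym_rtrancl symI) (simp add: insert_commute)
  then show "(x, y) \<in> conn E \<Longrightarrow> (y, x) \<in> conn E" unfolding conn_def by (rule symD)
qed

lemma conn_trans: "(x, y) \<in> conn E \<Longrightarrow> (y, z) \<in> conn E \<Longrightarrow> (x, z) \<in> conn E"
  unfolding conn_def by (rule rtrancl_trans)

lemma conn_mono: "A \<subseteq> B \<Longrightarrow> conn A \<subseteq> conn B"
  unfolding conn_def by (intro rtrancl_mono) blast

lemma conn_edge: "{x, y} \<in> E \<Longrightarrow> (x, y) \<in> conn E"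
  unfolding conn_def by blast

text \<open>A walk needs the new edge at most once, in one of its two directions. The mixed cases
  that arise from inserting both orientations collapse by transitivity.\<close>

lemma conn_insert:
  "(u, v) \<in> conn (insert {x, y} E) \<longleftrightarrow> (u, v) \<in> conn E \<or>
     (u, x) \<in> conn E \<and> (y, v) \<in> conn E \<or> (u, y) \<in> conn E \<and> (x, v) \<in> conn E"
proof -
  have "{(a, b). {a, b} \<in> insert {x, y} E} = insert (x, y) (insert (y, x) {(a, b). {a, b} \<in> E})"
    by (auto simp: doubleton_eq_iff)
  then have "conn (insert {x, y} E) = (insert (x, y) (insert (y, x) {(a, b). {a, b} \<in> E}))\<^sup>*"
    unfolding conn_def by simp
  then have "(u, v) \<in> conn (insert {x, y} E) \<longleftrightarrow>
      (u, v) \<in> conn E \<or> (u, y) \<in> conn E \<and> (x, v) \<in> conn E \<or>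
      ((u, x) \<in> conn E \<or> (u, y) \<in> conn E) \<and> ((y, v) \<in> conn E \<or> (x, v) \<in> conn E)"
    unfolding conn_def by (simp add: rtrancl_insert)
  moreover note conn_trans[of u x E v] conn_trans[of u y E v]
  ultimately show ?thesis by argo
qed

text \<open>Span in the graphic matroid of the coloured multigraph: colours are ignored, so copies
  of one edge are parallel. The second disjunct makes the closure axioms hold for arbitrary sets
  \<open>e\<close>, not only for unordered pairs.\<close>

definition edge_cl :: "('c \<times> 'v set) set \<Rightarrow> ('c \<times> 'v set) set" where
  "edge_cl A = {(i, e). (\<exists>x y. e = {x, y} \<and> (x, y) \<in> conn (snd ` A)) \<or> e \<in> snd ` A}"

lemma mem_edge_cl:
  "q \<in> edge_cl A \<longleftrightarrow> (\<exists>x y. snd q = {x, y} \<and> (x, y) \<in> conn (snd ` A)) \<or> snd q \<in> snd ` A"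
  unfolding edge_cl_def by (simp add: case_prod_beta)

lemma edge_cl_iff: "(i, {x, y}) \<in> edge_cl A \<longleftrightarrow> (x, y) \<in> conn (snd ` A)"
proof
  assume "(i, {x, y}) \<in> edge_cl A"
  then consider (conn) a b where "{x, y} = {a, b}" "(a, b) \<in> conn (snd ` A)" | (edge) "{x, y} \<in> snd ` A"
    unfolding edge_cl_def by blast
  then show "(x, y) \<in> conn (snd ` A)"
  proof cases
    case conn
    then show ?thesis using conn_sym[OF conn(2)] unfolding doubleton_eq_iff by (elim disjE) simp_all
  next
    case edge
    then show ?thesis by (rule conn_edge)
  qed
next
  assume "(x, y) \<in> conn (snd ` A)"
  then show "(i, {x, y}) \<in> edge_cl A" unfolding edge_cl_def by blast
qed

interpretation edge_cl: exchange_closure edge_cl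
proof
  fix A B :: "('c \<times> 'v set) set" and p q :: "'c \<times> 'v set"
  show "A \<subseteq> edge_cl A"
    unfolding edge_cl_def by (intro subsetI) (simp add: case_prod_beta)
  show "edge_cl A \<subseteq> edge_cl B" if "A \<subseteq> B"
  proof -
    have sub: "snd ` A \<subseteq> snd ` B" using that by (rule image_mono)
    show ?thesis
      unfolding edge_cl_def using conn_mono[OF sub] sub by (intro subsetI) (simp add: case_prod_beta subset_iff, metis)
  qed
  \<comment> \<open>A spanned pair already lies in one component, so taking the closure does not
    change connectivity.\<close>
  have "{(x, y). {x, y} \<in> snd ` edge_cl A} \<subseteq> conn (snd ` A)"
    by (auto simp: edge_cl_iff)
  then have conn: "conn (snd ` edge_cl A) \<subseteq> conn (snd ` A)"
    unfolding conn_def by (simp add: rtrancl_subset_rtrancl)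
  show "edge_cl (edge_cl A) \<subseteq> edge_cl A"
  proof
    fix q assume "q \<in> edge_cl (edge_cl A)"
    then consider x y where "snd q = {x, y}" "(x, y) \<in> conn (snd ` A)"
      | r where "r \<in> edge_cl A" "snd q = snd r"
      unfolding mem_edge_cl[of q "edge_cl A"] using conn by blast
    then show "q \<in> edge_cl A" unfolding mem_edge_cl by cases auto
  qed
  assume qp: "q \<in> edge_cl (insert p A)" "q \<notin> edge_cl A"
  show "p \<in> edge_cl (insert q A)"
  proof (cases "snd q = snd p")
    case True
    then have "snd p \<in> snd ` insert q A" by (metis insertI1 image_eqI)
    then show ?thesis unfolding edge_cl_def by (cases p) auto
  next
    case False
    then have "snd q \<notin> snd ` insert p A" using qp(2) unfolding edge_cl_def by (cases q) auto
    then obtain u v where q: "snd q = {u, v}" "(u, v) \<in> conn (snd ` insert p A)"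
      using qp(1) unfolding edge_cl_def by (cases q) auto
    have n: "(u, v) \<notin> conn (snd ` A)" using qp(2) q(1) edge_cl_iff by (metis prod.collapse)
    show ?thesis
    proof (cases "\<exists>x y. snd p = {x, y}")
      case True
      then obtain x y where p: "snd p = {x, y}" by blast
      have "(x, y) \<in> conn (snd ` insert q A)"
        using q(2) n unfolding image_insert p q(1) conn_insert
        by (blast intro: conn_sym conn_trans)
      then show ?thesis using p edge_cl_iff by (metis prod.collapse)
    next
      case False
      \<comment> \<open>A set that is not an unordered pair creates no adjacency, so
        \<open>q\<close> would already be spanned by \<open>A\<close>.\<close>
      then have "{(x, y). {x, y} \<in> snd ` insert p A} = {(x, y). {x, y} \<in> snd ` A}" by auto
      then show ?thesis using q(2) n unfolding conn_def by simp
    qed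
  qed
qed

text \<open>The values of \<open>f\<close> name the components. A new edge stays inside a component
  or merges two, so their number drops by at most one, and by exactly one if no cycle is closed. The
  last conjunct is the case of forests, expressed by the ends of each edge not being joined by the
  other edges.\<close>

lemma component_labelling:
  fixes V :: "'v set"
  assumes "finite V" "finite A" "A \<subseteq> complete_edges V"
  shows "\<exists>f :: 'v \<Rightarrow> 'v. (\<forall>u\<in>V. \<forall>v\<in>V. (u, v) \<in> conn A \<longleftrightarrow> f u = f v) \<and> card V \<le> card (f ` V) + card A \<and>
    ((\<forall>x y. {x, y} \<in> A \<longrightarrow> (x, y) \<notin> conn (A - {{x, y}})) \<longrightarrow> card V = card (f ` V) + card A)"
  using assms(2,3)
proof (induction A rule: finite_induct)
  case empty
  have "conn ({} :: 'v set set) = Id" unfolding conn_def by auto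
  then show ?case by (intro exI[of _ id]) simp
next
  case (insert e A)
  define ac :: "'v set set \<Rightarrow> bool"
    where "ac = (\<lambda>A. \<forall>x y. {x, y} \<in> A \<longrightarrow> (x, y) \<notin> conn (A - {{x, y}}))"
  obtain f :: "'v \<Rightarrow> 'v" where f: "\<And>u v. u \<in> V \<Longrightarrow> v \<in> V \<Longrightarrow> (u, v) \<in> conn A \<longleftrightarrow> f u = f v"
    "card V \<le> card (f ` V) + card A" "ac A \<Longrightarrow> card V = card (f ` V) + card A"
    using insert.IH insert.prems unfolding ac_def by auto
  obtain x y where e: "e = {x, y}" "x \<noteq> y" "x \<in> V" "y \<in> V"
    using insert.prems unfolding complete_edges_def by (auto simp: card_2_iff)
  have ac_sub: "ac A" if "ac (insert e A)"
    unfolding ac_def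
  proof (intro allI impI notI)
    fix a b assume "{a, b} \<in> A" "(a, b) \<in> conn (A - {{a, b}})"
    moreover have "conn (A - {{a, b}}) \<subseteq> conn (insert e A - {{a, b}})" by (intro conn_mono) blast
    ultimately show False using that unfolding ac_def by blast
  qed
  have "\<exists>g :: 'v \<Rightarrow> 'v. (\<forall>u\<in>V. \<forall>v\<in>V. (u, v) \<in> conn (insert e A) \<longleftrightarrow> g u = g v) \<and>
    card V \<le> card (g ` V) + card (insert e A) \<and>
    (ac (insert e A) \<longrightarrow> card V = card (g ` V) + card (insert e A))"
  proof (cases "f x = f y")
    case True
    then have xy: "(x, y) \<in> conn A" using f e by blast
    \<comment> \<open>The new edge closes a cycle, so the claim of equality is void and the old
      labels serve.\<close>
    then have "\<not> ac (insert e A)" unfolding ac_def using e insert.hyps(2) by auto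
    moreover have "(u, v) \<in> conn (insert e A) \<longleftrightarrow> (u, v) \<in> conn A" for u v
      unfolding e(1) conn_insert using xy by (blast intro: conn_sym conn_trans)
    ultimately show ?thesis using f insert.hyps by (intro exI[of _ f]) auto
  next
    case False
    define g where "g u = (if f u = f x then f y else f u)" for u
    have g_img: "g ` V = f ` V - {f x}"
      unfolding g_def using e False by auto
    have "finite (f ` V)" using assms(1) by simp
    then have "card (f ` V) = Suc (card (g ` V))"
      unfolding g_img using e by (intro card.remove) auto
    moreover have "(u, v) \<in> conn (insert e A) \<longleftrightarrow> g u = g v" if "u \<in> V" "v \<in> V" for u v
      unfolding e(1) conn_insert g_def using f(1) that e False by auto
    ultimately show ?thesis using f insert.hyps ac_sub by (intro exI[of _ g]) auto
  qed
  then show ?case unfolding ac_def .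
qed

text \<open>A cycle without its closing edge is a path between the ends of that edge.\<close>

lemma cycle_imp_conn:
  assumes "has_cycle E"
  shows "\<exists>x y. {x, y} \<in> E \<and> (x, y) \<in> conn (E - {{x, y}})"
proof -
  obtain vs where vs: "length vs \<ge> 3" "distinct vs" "{last vs, hd vs} \<in> E"
    and edge: "\<And>i. Suc i < length vs \<Longrightarrow> {vs ! i, vs ! Suc i} \<in> E"
    using assms unfolding has_cycle_def by blast
  define m where "m = length vs - 1"
  have ne: "vs \<noteq> []" using vs(1) by auto
  have ends: "hd vs = vs ! 0" "last vs = vs ! m" and m: "m \<ge> 2" "m < length vs"
    using vs(1) hd_conv_nth[of vs] last_conv_nth[of vs] unfolding m_def by (cases vs; auto)+
  let ?E' = "E - {{vs ! 0, vs ! m}}"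
  have "(vs ! 0, vs ! i) \<in> conn ?E'" if "i < length vs" for i
    using that
  proof (induction i)
    case (Suc i)
    \<comment> \<open>An edge of the path could equal the closing edge only for \<open>i = 0\<close>
      and \<open>m = 1\<close>, which length at least 3 excludes.\<close>
    have "\<not> (i = 0 \<and> Suc i = m)" "i \<noteq> m" using m Suc.prems unfolding m_def by auto
    then have "{vs ! i, vs ! Suc i} \<noteq> {vs ! 0, vs ! m}"
      using nth_eq_iff_index_eq[OF vs(2), of i 0] nth_eq_iff_index_eq[OF vs(2), of i m] Suc.prems m ne
        nth_eq_iff_index_eq[OF vs(2), of "Suc i" m]
      unfolding doubleton_eq_iff by auto
    then have "(vs ! i, vs ! Suc i) \<in> conn ?E'" using edge Suc.prems by (intro conn_edge) auto
    then show ?case using Suc conn_trans by force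
  qed simp
  then show ?thesis using m vs(3) unfolding ends by (metis insert_commute)
qed

section \<open>Rainbow spanning trees versus obstructing partitions\<close>

lemma finite_RS_board: "finite (RS_board n)"
proof -
  have "RS_board n \<subseteq> {1..n-1} \<times> Pow {1..n}" unfolding RS_board_def complete_edges_def by auto
  then show ?thesis by (rule finite_subset) simp
qed

text \<open>Rado's theorem in the graphic matroid. A rainbow independent set with all n - 1 colours
  is a spanning tree. Otherwise the parts are the components of \<open>D\<close>: there are at least
  n - card D of them, more than n - card R, and edges with colours in \<open>R\<close> stay inside
  the parts.\<close>

lemma rainbow_spanning_tree_or_obstruction:
  assumes "E \<subseteq> RS_board n" "n \<ge> 1"
  shows "(\<exists>T\<in>rainbow_spanning_trees n. T \<subseteq> E) \<or>
    (\<exists>R f. R \<subseteq> {1..n-1} \<and> n < card (f ` {1..n}) + card R \<and>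
      (\<forall>i\<in>R. \<forall>u\<in>{1..n}. \<forall>v\<in>{1..n}. (i, {u, v}) \<in> E \<longrightarrow> f u = (f v :: nat)))"
proof -
  let ?V = "{1..n}"
  have fin: "finite E" "fst ` E \<subseteq> {1..n-1}"
    using assms(1) finite_subset[OF assms(1) finite_RS_board] unfolding RS_board_def by auto
  have snd_E: "snd ` E \<subseteq> complete_edges ?V"
    using assms(1) unfolding RS_board_def by auto
  from edge_cl.rainbow_basis_or_obstruction[OF fin(1) finite_atLeastAtMost fin(2)]
  consider (tree) T where "T \<subseteq> E" "edge_cl.indep T" "inj_on fst T" "fst ` T = {1..n-1}"
    | (obstr) R D where "R \<subseteq> {1..n-1}" "D \<subseteq> E" "card D < card R"
        "\<And>e. e \<in> E \<Longrightarrow> fst e \<in> R \<Longrightarrow> e \<in> edge_cl D"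
    by metis
  then show ?thesis
  proof cases
    case tree
    have inj: "inj_on snd T"
    proof (rule inj_onI, rule ccontr)
      fix p q assume pq: "p \<in> T" "q \<in> T" "snd p = snd q" "p \<noteq> q"
      then have "snd p \<in> snd ` (T - {p})" by auto
      then show False using tree(2) pq(1) unfolding edge_cl.indep_def mem_edge_cl by blast
    qed
    have ac: "(x, y) \<notin> conn (snd ` T - {{x, y}})" if xy_T: "{x, y} \<in> snd ` T" for x y
    proof
      assume xy: "(x, y) \<in> conn (snd ` T - {{x, y}})"
      obtain p where p: "{x, y} = snd p" "p \<in> T" using xy_T by (rule imageE)
      have "snd ` T - {{x, y}} \<subseteq> snd ` (T - {p})"
        using image_diff_subset[of snd T "{p}"] p(1) by simp
      then have "(x, y) \<in> conn (snd ` (T - {p}))" using xy conn_mono by blast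
      then show False
        using tree(2) p(2) p(1)[symmetric] unfolding edge_cl.indep_def mem_edge_cl by blast
    qed
    have cardT: "card (snd ` T) = n - 1"
      using card_image[OF inj] card_image[OF tree(3)] tree(4) by simp
    have sub: "snd ` T \<subseteq> complete_edges ?V" using tree(1) snd_E by blast
    have finT: "finite (snd ` T)" using tree(1) fin(1) finite_subset by blast
    obtain f :: "nat \<Rightarrow> nat"
      where f: "\<forall>u\<in>?V. \<forall>v\<in>?V. (u, v) \<in> conn (snd ` T) \<longleftrightarrow> f u = f v"
        "card ?V = card (f ` ?V) + card (snd ` T)"
      using component_labelling[OF finite_atLeastAtMost finT sub] ac by blast
    \<comment> \<open>A forest with n - 1 edges on n vertices has one component.\<close>
    have "card (f ` ?V) = 1" using f(2) cardT assms(2) by simp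
    then obtain z where "f ` ?V = {z}" by (rule card_1_singletonE)
    then have "f u = z" if "u \<in> ?V" for u using that by blast
    then have "graph_connected ?V (snd ` T)"
      using f(1) unfolding graph_connected_def conn_def by simp
    moreover have "\<not> has_cycle (snd ` T)" using cycle_imp_conn ac by blast
    ultimately have "is_spanning_tree ?V (snd ` T)"
      using sub unfolding is_spanning_tree_def by blast
    moreover have "\<exists>!e. (i, e) \<in> T" if "i \<in> {1..n-1}" for i
    proof -
      from that obtain p where "p \<in> T" "fst p = i" unfolding tree(4)[symmetric] by blast
      then have "(i, snd p) \<in> T" by auto
      moreover have "e = snd p" if "(i, e) \<in> T" for e
        using inj_onD[OF tree(3) _ \<open>(i, e) \<in> T\<close> calculation] by simp
      ultimately show ?thesis by blast
    qed
    ultimately have "T \<in> rainbow_spanning_trees n"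
      using tree(1) assms(1) inj unfolding rainbow_spanning_trees_def by blast
    then show ?thesis using tree(1) by blast
  next
    case obstr
    have finD: "finite D" using obstr(2) fin(1) finite_subset by blast
    have sub: "snd ` D \<subseteq> complete_edges ?V" using obstr(2) snd_E by blast
    obtain f :: "nat \<Rightarrow> nat"
      where f: "\<forall>u\<in>?V. \<forall>v\<in>?V. (u, v) \<in> conn (snd ` D) \<longleftrightarrow> f u = f v"
        "card ?V \<le> card (f ` ?V) + card (snd ` D)"
      using component_labelling[OF finite_atLeastAtMost finite_imageI[OF finD] sub] by blast
    have "n < card (f ` ?V) + card R" using f(2) obstr(3) card_image_le[OF finD, of snd] by simp
    moreover have "f u = f v" if "i \<in> R" "u \<in> ?V" "v \<in> ?V" "(i, {u, v}) \<in> E" for i u v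
      using obstr(4)[OF that(4)] that f(1) by (simp add: edge_cl_iff)
    ultimately show ?thesis using obstr(1) by blast
  qed
qed

section \<open>A potential criterion for Maker\<close>

definition unhit :: "'a set set \<Rightarrow> 'a set \<Rightarrow> 'a set set" where
  "unhit H M = {A\<in>H. A \<inter> M = {}}"

text \<open>The exponent counts what Breaker still lacks of \<open>A\<close>, so a set that he owns
  completely has danger 1. The scale \<open>\<beta>\<close> is real so that a non-integer bound on
  the bias can be used.\<close>

definition danger :: "real \<Rightarrow> 'a set \<Rightarrow> 'a set \<Rightarrow> real" where
  "danger \<beta> B A = 2 powr (- real (card (A - B)) / \<beta>)"

text \<open>Convexity: the exponential lies below its chord on the unit interval, obtained as the
  weighted mean inequality for 2 and 1.\<close>

lemma two_powr_le: "0 \<le> t \<Longrightarrow> t \<le> 1 \<Longrightarrow> 2 powr t \<le> 1 + (t :: real)"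
  using Youngs_inequality_0[of t "1 - t" 2 1] by simp

text \<open>Breaker's move multiplies the danger by a power of 2 with exponent at most 1. The chord
  bound makes the growth linear in \<open>card (A \<inter> S)\<close>, so it can be summed element
  by element.\<close>

lemma danger_le:
  assumes "finite A" "S \<inter> B = {}" "finite S" "real (card S) \<le> \<beta>" "\<beta> > 0"
  shows "danger \<beta> (B \<union> S) A \<le> danger \<beta> B A + danger \<beta> B A * card (A \<inter> S) / \<beta>"
proof -
  have "A - B = (A - (B \<union> S)) \<union> (A \<inter> S)" "(A - (B \<union> S)) \<inter> (A \<inter> S) = {}" using assms(2) by auto
  then have c: "card (A - B) = card (A - (B \<union> S)) + card (A \<inter> S)"
    using assms(1) by (metis card_Un_disjoint finite_Diff finite_Int)
  have "card (A \<inter> S) \<le> card S" using assms(3) by (intro card_mono) auto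
  then have "real (card (A \<inter> S)) / \<beta> \<le> 1" using assms(4,5) by (simp add: divide_le_eq)
  then have le: "2 powr (card (A \<inter> S) / \<beta>) \<le> 1 + card (A \<inter> S) / \<beta>"
    using assms(5) by (intro two_powr_le) auto
  have "danger \<beta> (B \<union> S) A = danger \<beta> B A * 2 powr (card (A \<inter> S) / \<beta>)"
    unfolding danger_def c powr_add[symmetric] using assms(5) by (simp add: field_simps)
  also have "\<dots> \<le> danger \<beta> B A * (1 + card (A \<inter> S) / \<beta>)"
    using le by (intro mult_left_mono) (simp_all add: danger_def)
  finally show ?thesis by (simp add: algebra_simps)
qed

text \<open>The Erdos--Selfridge--Beck argument for a biased game in which the player with bias 1 moves
  first and wants to hit every member of \<open>H\<close>: she claims an element of maximal danger.\<close>

lemma maker_wins_from_potential: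
  fixes H F :: "'a set set" and \<beta> :: real
  assumes "finite X" "finite H" "\<And>A. A \<in> H \<Longrightarrow> A \<subseteq> X" "real b \<le> \<beta>" "\<beta> > 0"
    and goal: "\<And>M. M \<subseteq> X \<Longrightarrow> (\<And>A. A \<in> H \<Longrightarrow> A \<inter> M \<noteq> {}) \<Longrightarrow> \<exists>W\<in>F. W \<subseteq> M"
    and "M \<subseteq> X" "(\<Sum>A\<in>unhit H M. danger \<beta> B A) < 1"
  shows "maker_wins_from X F b M B"
  using assms(7-)
proof (induction "card (X - (M \<union> B))" arbitrary: M B rule: less_induct)
  case less
  define L where "L = X - (M \<union> B)"
  have finL: "finite L" unfolding L_def using assms(1) by simp
  have finH: "finite (unhit H M')" for M' unfolding unhit_def using assms(2) by simp
  show ?case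
  proof (cases "L = {}")
    case True
    \<comment> \<open>With no free element left, an unhit set belongs to Breaker and alone has
      danger 1.\<close>
    have "A \<inter> M \<noteq> {}" if "A \<in> H" for A
    proof
      assume "A \<inter> M = {}"
      then have A: "A \<in> unhit H M" "A - B = {}"
        using that assms(3)[OF that] True unfolding unhit_def L_def by auto
      have "danger \<beta> B A \<le> (\<Sum>A\<in>unhit H M. danger \<beta> B A)"
        using A(1) finH by (intro member_le_sum) (auto simp: danger_def)
      then show False using less.prems(2) A(2) unfolding danger_def by simp
    qed
    then obtain W where "W \<in> F" "W \<subseteq> M" using goal less.prems(1) by blast
    then show ?thesis by (rule maker_wins_from.won)
  next
    case False
    \<comment> \<open>\<open>ph y\<close> is the total danger that Maker removes by claiming
      \<open>y\<close>.\<close>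
    define ph where "ph y = (\<Sum>A\<in>{A\<in>unhit H M. y \<in> A}. danger \<beta> B A)" for y
    have "Max (ph ` L) \<in> ph ` L" using False finL by (intro Max_in) auto
    then obtain x where x: "x \<in> L" "ph x = Max (ph ` L)" by auto
    then have xmax: "ph y \<le> ph x" if "y \<in> L" for y using that finL by simp
    show ?thesis
    proof (rule maker_wins_from.move)
      show "x \<in> X - (M \<union> B)" using x unfolding L_def by simp
      fix S assume S: "S \<subseteq> X - (M \<union> B) - {x}" "card S = min b (card (X - (M \<union> B) - {x}))"
      have SL: "S \<subseteq> L" "S \<inter> B = {}" "finite S"
        using S(1) finL finite_subset unfolding L_def by blast+
      have cS: "real (card S) \<le> \<beta>" using S(2) assms(4) by simp
      \<comment> \<open>Double counting over Breaker's elements: each contributes at most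
        \<open>ph x\<close> by the choice of \<open>x\<close>, and there are at most
        \<open>\<beta>\<close> of them.\<close>
      have sumL: "(\<Sum>A\<in>unhit H M. danger \<beta> B A * card (A \<inter> S)) \<le> \<beta> * ph x"
      proof -
        have "(\<Sum>A\<in>unhit H M. danger \<beta> B A * card (A \<inter> S)) =
            (\<Sum>A\<in>unhit H M. \<Sum>y\<in>S. if y \<in> A then danger \<beta> B A else 0)"
        proof (rule sum.cong[OF refl])
          fix A
          have "(\<Sum>y\<in>S. if y \<in> A then danger \<beta> B A else 0) = (\<Sum>y\<in>S \<inter> A. danger \<beta> B A)"
            using sum.inter_restrict[OF SL(3), of "\<lambda>_. danger \<beta> B A" A] by simp
          then show "danger \<beta> B A * card (A \<inter> S) = (\<Sum>y\<in>S. if y \<in> A then danger \<beta> B A else 0)"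
            by (simp add: Int_commute)
        qed
        also have "\<dots> = (\<Sum>y\<in>S. \<Sum>A\<in>unhit H M. if y \<in> A then danger \<beta> B A else 0)"
          by (rule sum.swap)
        also have "\<dots> = (\<Sum>y\<in>S. ph y)"
          unfolding ph_def using finH by (simp add: sum.inter_filter)
        also have "\<dots> \<le> (\<Sum>y\<in>S. ph x)" using xmax SL(1) by (intro sum_mono) blast
        also have "\<dots> \<le> \<beta> * ph x"
          using cS unfolding ph_def by (simp add: mult_right_mono sum_nonneg danger_def)
        finally show ?thesis .
      qed
      have unhit_insert: "unhit H (insert x M) = unhit H M - {A\<in>unhit H M. x \<in> A}"
        unfolding unhit_def by auto
      have split: "(\<Sum>A\<in>unhit H M. danger \<beta> B A) =
          (\<Sum>A\<in>unhit H (insert x M). danger \<beta> B A) + ph x"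
        unfolding ph_def unhit_insert using finH by (intro sum.subset_diff) auto
      \<comment> \<open>Maker's move lowers the total by \<open>ph x\<close> and Breaker's reply
        raises it by at most \<open>ph x\<close>, so it stays below 1.\<close>
      have "(\<Sum>A\<in>unhit H (insert x M). danger \<beta> (B \<union> S) A) \<le>
          (\<Sum>A\<in>unhit H (insert x M). danger \<beta> B A + danger \<beta> B A * card (A \<inter> S) / \<beta>)"
      proof (rule sum_mono)
        fix A assume "A \<in> unhit H (insert x M)"
        then have "finite A" using assms(1,3) finite_subset unfolding unhit_def by blast
        then show "danger \<beta> (B \<union> S) A \<le> danger \<beta> B A + danger \<beta> B A * card (A \<inter> S) / \<beta>"
          using danger_le SL cS assms(5) by blast
      qed
      also have "\<dots> = (\<Sum>A\<in>unhit H (insert x M). danger \<beta> B A) +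
          (\<Sum>A\<in>unhit H (insert x M). danger \<beta> B A * card (A \<inter> S)) / \<beta>"
        by (simp add: sum.distrib sum_divide_distrib)
      also have "(\<Sum>A\<in>unhit H (insert x M). danger \<beta> B A * card (A \<inter> S)) \<le>
          (\<Sum>A\<in>unhit H M. danger \<beta> B A * card (A \<inter> S))"
        unfolding unhit_insert using finH by (intro sum_mono2) (auto simp: danger_def)
      also note sumL
      finally have "(\<Sum>A\<in>unhit H (insert x M). danger \<beta> (B \<union> S) A) < 1"
        using less.prems(2) split assms(5) by (simp add: divide_right_mono)
      moreover have "card (X - (insert x M \<union> (B \<union> S))) < card (X - (M \<union> B))"
        using x(1) finL unfolding L_def by (intro psubset_card_mono) auto
      moreover have "insert x M \<subseteq> X" using x(1) less.prems(1) unfolding L_def by blast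
      ultimately show "maker_wins_from X F b (insert x M) (B \<union> S)"
        using less.hyps by blast
    qed
  qed
qed

section \<open>A box game for Breaker\<close>

text \<open>Maker's winning positions are defined inductively, so a class of positions without a
  completed winning set in which Breaker can always stay is disjoint from them.\<close>

lemma not_maker_wins_from_invariant:
  fixes good :: "'a set \<Rightarrow> 'a set \<Rightarrow> bool"
  assumes "good M B"
    and unwon: "\<And>M B W. good M B \<Longrightarrow> W \<in> F \<Longrightarrow> \<not> W \<subseteq> M"
    and reply: "\<And>M B x. good M B \<Longrightarrow> x \<in> X - (M \<union> B) \<Longrightarrow>
      \<exists>S\<subseteq>X - (M \<union> B) - {x}. card S = min b (card (X - (M \<union> B) - {x})) \<and> good (insert x M) (B \<union> S)"
  shows "\<not> maker_wins_from X F b M B"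
proof
  assume "maker_wins_from X F b M B"
  then show False using assms(1)
  proof (induction rule: maker_wins_from.induct)
    case won
    then show ?case using unwon by blast
  next
    case (move x M B)
    then show ?case using reply[of M B x] by blast
  qed
qed

text \<open>Breaker keeps \<open>k\<close> boxes free of Maker's elements, for \<open>k\<close> decreasing by one per round, and
  spreads his elements evenly over them.\<close>

lemma not_maker_wins_boxes:
  assumes "finite X" "finite K" "K \<noteq> {}"
    and F: "\<And>W i. W \<in> F \<Longrightarrow> i \<in> K \<Longrightarrow> \<exists>w\<in>W. col w = i"
    and size: "\<And>i. i \<in> K \<Longrightarrow> card {x\<in>X. col x = i} \<le> (\<Sum>j\<in>{1..<card K}. b div j)"
  shows "\<not> maker_wins X F b"
proof -
  define box where "box B i = {x\<in>X - B. col x = i}" for B i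
  \<comment> \<open>When \<open>k\<close> boxes remain after Maker's move, Breaker can take
    \<open>b div k\<close> elements from each. The sum is therefore the budget for emptying a box
    while the number of live boxes falls from \<open>card C\<close> to 1.\<close>
  define good where "good M B \<longleftrightarrow> (\<exists>C\<subseteq>K. C \<noteq> {} \<and> (\<forall>i\<in>C. (\<forall>x\<in>M. col x \<noteq> i) \<and>
      card (box B i) \<le> (\<Sum>j\<in>{1..<card C}. b div j)))" for M B
  have finbox: "finite (box B i)" for B i unfolding box_def using assms(1) by simp
  have "\<not> maker_wins_from X F b {} {}"
  proof (rule not_maker_wins_from_invariant[of good])
    show "good {} {}" unfolding good_def box_def using assms(3) size by (intro exI[of _ K]) auto
  next
    fix M B W assume "good M B" "W \<in> F"
    then show "\<not> W \<subseteq> M" using F unfolding good_def by blast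
  next
    fix M B x assume i: "good M B" and x: "x \<in> X - (M \<union> B)"
    define L where "L = X - (M \<union> B) - {x}"
    have finL: "finite L" unfolding L_def using assms(1) by simp
    obtain C where C: "C \<subseteq> K" "C \<noteq> {}" "\<And>i y. i \<in> C \<Longrightarrow> y \<in> M \<Longrightarrow> col y \<noteq> i"
      "\<And>i. i \<in> C \<Longrightarrow> card (box B i) \<le> (\<Sum>j\<in>{1..<card C}. b div j)"
      using i unfolding good_def by blast
    have finC: "finite C" using C(1) assms(2) finite_subset by blast
    have "\<exists>S\<subseteq>L. card S = min b (card L) \<and> good (insert x M) (B \<union> S)"
    proof (cases "card C = 1")
      case True
      \<comment> \<open>For one box the budget is an empty sum: the box is already Breaker's, Maker
        cannot enter it, and any reply will do.\<close>
      have empty: "box B i = {}" if "i \<in> C" for i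
        using C(4)[OF that] True finbox[of B i] by simp
      obtain S where S: "S \<subseteq> L" "card S = min b (card L)"
        using obtain_subset_with_card_n[of "min b (card L)" L] by auto
      have "col y \<noteq> i \<and> box (B \<union> S) i = {}" if "i \<in> C" "y \<in> insert x M" for i y
        using C(3)[OF that(1)] empty[OF that(1)] that(2) x unfolding box_def by auto
      moreover have "box (B \<union> S) i = {}" if "i \<in> C" for i
        using empty[OF that] unfolding box_def by auto
      ultimately have "good (insert x M) (B \<union> S)"
        unfolding good_def using C(1,2) by (intro exI[of _ C]) auto
      then show ?thesis using S by blast
    next
      case False
      define k where "k = card C - 1"
      have "card C \<noteq> 0" using C(2) finC by simp
      then have k: "k \<ge> 1" "card C = Suc k" using False unfolding k_def by auto
      \<comment> \<open>Maker spoils at most one box; if she spoils none, one is given up anyway to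
        keep the count.\<close>
      have "k \<le> card (C - {col x})"
        unfolding k_def using finC by (simp add: card_Diff_singleton_if)
      then obtain C' where C': "C' \<subseteq> C - {col x}" "card C' = k"
        using obtain_subset_with_card_n by metis
      have finC': "finite C'" using C'(1) finC finite_subset by blast
      have "\<exists>Q\<subseteq>box B i. card Q = min (b div k) (card (box B i))" for i
        using obtain_subset_with_card_n[of "min (b div k) (card (box B i))" "box B i"]
        by (metis min.cobounded2)
      then obtain Q where Q: "\<And>i. Q i \<subseteq> box B i" "\<And>i. card (Q i) = min (b div k) (card (box B i))"
        by metis
      have QL: "(\<Union>i\<in>C'. Q i) \<subseteq> L"
      proof
        fix y assume "y \<in> (\<Union>i\<in>C'. Q i)"
        then obtain i where "i \<in> C'" "y \<in> box B i" using Q(1) by blast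
        then show "y \<in> L" using C(3)[of i] C'(1) unfolding L_def box_def by auto
      qed
      have "card (\<Union>i\<in>C'. Q i) \<le> (\<Sum>i\<in>C'. card (Q i))" using finC' by (rule card_UN_le)
      also have "\<dots> \<le> (\<Sum>i\<in>C'. b div k)" by (intro sum_mono) (simp add: Q(2))
      also have "\<dots> \<le> b" using C'(2) by (simp add: mult.commute)
      finally have "card (\<Union>i\<in>C'. Q i) \<le> min b (card L)"
        using card_mono[OF finL QL] by simp
      \<comment> \<open>The rules fix the size of a reply, so the planned elements are padded
        arbitrarily.\<close>
      then obtain S where S: "(\<Union>i\<in>C'. Q i) \<subseteq> S" "S \<subseteq> L" "card S = min b (card L)"
        using exists_subset_between[OF _ _ QL finL, of "min b (card L)"] by auto
      have "card (box (B \<union> S) i) \<le> (\<Sum>j\<in>{1..<card C'}. b div j)" if i: "i \<in> C'" for i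
      proof -
        have "box (B \<union> S) i \<subseteq> box B i - Q i" using S(1) i unfolding box_def by auto
        then have "card (box (B \<union> S) i) \<le> card (box B i - Q i)" using finbox by (intro card_mono) auto
        also have "\<dots> = card (box B i) - min (b div k) (card (box B i))"
          using Q finbox finite_subset card_Diff_subset by metis
        also have "\<dots> \<le> (\<Sum>j\<in>{1..<card C}. b div j) - b div k"
          using C(4)[of i] C'(1) i by auto
        also have "\<dots> = (\<Sum>j\<in>{1..<card C'}. b div j)"
          using k C'(2) by (simp add: sum.atLeastLessThan_Suc)
        finally show ?thesis .
      qed
      moreover have "col y \<noteq> i" if "i \<in> C'" "y \<in> insert x M" for i y
        using that C(3)[of i y] C'(1) by auto
      moreover have "C' \<noteq> {}" using C'(2) k(1) by auto
      ultimately have "good (insert x M) (B \<union> S)"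
        unfolding good_def using C(1) C'(1) by (intro exI[of _ C']) blast
      then show ?thesis using S by blast
    qed
    then show "\<exists>S\<subseteq>X - (M \<union> B) - {x}. card S = min b (card (X - (M \<union> B) - {x})) \<and>
        good (insert x M) (B \<union> S)" unfolding L_def .
  qed
  then show ?thesis unfolding maker_wins_def .
qed

section \<open>Breaker's side: the upper bound on the threshold\<close>

lemma card_complete_edges: "finite V \<Longrightarrow> card (complete_edges V) = card V choose 2"
  unfolding complete_edges_def by (rule n_subsets)

lemma not_maker_wins_RS:
  assumes "n \<ge> 2" "n choose 2 \<le> (\<Sum>j\<in>{1..<n-1}. b div j)"
  shows "\<not> maker_wins (RS_board n) (rainbow_spanning_trees n) b"
proof (rule not_maker_wins_boxes[where K = "{1..n-1}" and col = fst])
  fix i assume i: "i \<in> {1..n-1}"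
  have "{x \<in> RS_board n. fst x = i} \<subseteq> Pair i ` complete_edges {1..n}" unfolding RS_board_def by auto
  then have "card {x \<in> RS_board n. fst x = i} \<le> card (complete_edges {1..n})"
    by (rule surj_card_le[rotated]) (simp add: complete_edges_def)
  then show "card {x \<in> RS_board n. fst x = i} \<le> (\<Sum>j\<in>{1..<card {1..n-1}}. b div j)"
    using assms(2) by (simp add: card_complete_edges)
next
  fix W i assume "W \<in> rainbow_spanning_trees n" "i \<in> {1..n-1}"
  then show "\<exists>w\<in>W. fst w = i" unfolding rainbow_spanning_trees_def by force
qed (use assms(1) finite_RS_board in auto)

text \<open>Since \<open>b div j\<close> is at least b/j - 1, the budget is at least b * ln (n - 1)
  - n, about n^2, against the box size of about n^2/2. The second conjunct says that the least bias
  in \<open>RS_threshold\<close> is attained, which the lower bound needs.\<close>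

lemma RS_threshold_upper:
  "\<forall>\<^sub>F n in sequentially. real (RS_threshold n) \<le> real n ^ 2 / ln (real n) \<and>
     \<not> maker_wins (RS_board n) (rainbow_spanning_trees n) (RS_threshold n)"
proof -
  have "\<forall>\<^sub>F n in sequentially. real n * (real n - 1) / 2 \<le>
      (real n ^ 2 / ln (real n) - 1) * ln (real n - 1) - real n"
    by real_asymp
  with eventually_ge_at_top[of 3] show ?thesis
  proof eventually_elim
    case (elim n)
    define b where "b = nat \<lfloor>real n ^ 2 / ln (real n)\<rfloor>"
    have ln_n: "ln (real n) > 0" using elim(1) by simp
    then have b: "real b \<le> real n ^ 2 / ln (real n)" "real n ^ 2 / ln (real n) - 1 \<le> real b"
      unfolding b_def by auto
    have div_ge: "real b / real j - 1 \<le> real (b div j)" if "j \<ge> 1" for j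
      using floor_divide_of_nat_eq[of b j, where 'a = real] by linarith
    have "real (n choose 2) = real n * (real n - 1) / 2"
      using elim(1) by (simp add: choose_two real_of_nat_div of_nat_diff)
    also have "\<dots> \<le> (real n ^ 2 / ln (real n) - 1) * ln (real n - 1) - real n" using elim(2) .
    also have "\<dots> \<le> real b * ln (real n - 1) - real n"
      using b(2) elim(1) by (intro diff_right_mono mult_right_mono) auto
    also have "\<dots> \<le> real b * harm (n - 2) - real n"
      using ln_le_harm[of "n - 2"] elim(1)
      by (intro diff_right_mono mult_left_mono) (simp_all add: of_nat_diff)
    also have "\<dots> \<le> (\<Sum>j\<in>{1..n-2}. real b / real j - 1)"
      using elim(1) by (simp add: harm_def sum_subtractf sum_distrib_left divide_inverse)
    also have "\<dots> \<le> (\<Sum>j\<in>{1..n-2}. real (b div j))" by (intro sum_mono div_ge) auto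
    also have "{1..n-2} = {1..<n-1}" using elim(1) by auto
    finally have "n choose 2 \<le> (\<Sum>j\<in>{1..<n-1}. b div j)"
      by (simp flip: of_nat_sum)
    then have "\<not> maker_wins (RS_board n) (rainbow_spanning_trees n) b"
      using elim(1) by (intro not_maker_wins_RS) auto
    then have "RS_threshold n \<le> b" "\<not> maker_wins (RS_board n) (rainbow_spanning_trees n) (RS_threshold n)"
      unfolding RS_threshold_def threshold_bias_def by (rule Least_le, rule LeastI)
    then show ?case using b(1) by linarith
  qed
qed

section \<open>Obstructions to a rainbow spanning tree\<close>

definition edges_leaving :: "'v set \<Rightarrow> 'v set \<Rightarrow> 'v set set" where
  "edges_leaving V W = complete_edges V - complete_edges W"

definition cut_edges :: "'v set \<Rightarrow> 'v set \<Rightarrow> 'v set set" where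
  "cut_edges V U = (\<lambda>(u, v). {u, v}) ` (U \<times> (V - U))"

text \<open>With at least n - k + 1 parts, at most 2k - 2 vertices lie in parts of size at least 2,
  and \<open>W\<close> is to contain them. Enlarging \<open>W\<close> only shrinks the set to be
  hit, so one exact size suffices.\<close>

definition few_colours :: "nat \<Rightarrow> nat \<Rightarrow> (nat \<times> nat set) set set" where
  "few_colours n k = (\<lambda>(I, W). I \<times> edges_leaving {1..n} W) `
     ({I. I \<subseteq> {1..n-1} \<and> card I = k} \<times> {W. W \<subseteq> {1..n} \<and> card W = 2 * k - 2})"

definition balanced_cuts :: "nat \<Rightarrow> (nat \<times> nat set) set set" where
  "balanced_cuts n = (\<lambda>(I, U). I \<times> cut_edges {1..n} U) `
     ({I. I \<subseteq> {1..n-1} \<and> n \<le> 5 * card I} \<times> {U. U \<subseteq> {1..n} \<and> n \<le> 3 * card U \<and> 3 * card U \<le> 2 * n})"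

text \<open>If the complement of \<open>U\<close> is a single part, there are at most t + 1 parts,
  hence at least n - t colours that do not cross the cut.\<close>

definition small_cuts :: "nat \<Rightarrow> nat \<Rightarrow> (nat \<times> nat set) set set" where
  "small_cuts n t = (\<lambda>(I, U). I \<times> cut_edges {1..n} U) `
     ({I. I \<subseteq> {1..n-1} \<and> card I = n - t} \<times> {U. U \<subseteq> {1..n} \<and> card U = t})"

definition obstructions :: "nat \<Rightarrow> (nat \<times> nat set) set set" where
  "obstructions n = (\<Union>k\<in>{k. 1 \<le> k \<and> 5 * k \<le> n}. few_colours n k) \<union>
     (balanced_cuts n \<union> (\<Union>t\<in>{t. 1 \<le> t \<and> 3 * t < n}. small_cuts n t))"

text \<open>If w points lie in fibres of size at least 2, these fibres number at most w/2, so
  \<open>f\<close> has at most card V - w/2 values.\<close>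

lemma card_nonsingleton_fibres:
  assumes "finite V"
  shows "card {v\<in>V. \<exists>u\<in>V. u \<noteq> v \<and> f u = f v} \<le> 2 * (card V - card (f ` V))"
proof -
  define W where "W = {v\<in>V. \<exists>u\<in>V. u \<noteq> v \<and> f u = f v}"
  have WV: "W \<subseteq> V" unfolding W_def by auto
  then have finW: "finite W" using assms finite_subset by blast
  have fibre: "2 \<le> card {v\<in>W. f v = y}" if "y \<in> f ` W" for y
  proof -
    from that obtain v where v: "v \<in> W" "y = f v" by blast
    then obtain u where u: "u \<in> V" "u \<noteq> v" "f u = f v" "v \<in> V" unfolding W_def by blast
    then have "{u, v} \<subseteq> {v\<in>W. f v = y}" using v unfolding W_def by auto
    then have "card {u, v} \<le> card {v\<in>W. f v = y}" using finW by (intro card_mono) auto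
    then show ?thesis using u(2) by simp
  qed
  have "2 * card (f ` W) = (\<Sum>y\<in>f ` W. 2)" by simp
  also have "\<dots> \<le> (\<Sum>y\<in>f ` W. card {v\<in>W. f v = y})" using fibre by (intro sum_mono)
  also have "\<dots> = card W"
    using sum.group[OF finW finite_imageI[OF finW, of f], of f "\<lambda>_. 1 :: nat"] by simp
  finally have "2 * card (f ` W) \<le> card W" .
  moreover have "card (f ` V) \<le> card (f ` W) + card (V - W)"
  proof -
    have "f ` V = f ` W \<union> f ` (V - W)" using WV by blast
    then have "card (f ` V) \<le> card (f ` W) + card (f ` (V - W))" by (simp add: card_Un_le)
    also have "card (f ` (V - W)) \<le> card (V - W)" using assms by (intro card_image_le) auto
    finally show ?thesis by simp
  qed
  moreover have "card (V - W) = card V - card W" "card W \<le> card V"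
    using WV assms finW by (simp_all add: card_Diff_subset card_mono)
  ultimately have "card W \<le> 2 * (card V - card (f ` V))" by linarith
  then show ?thesis unfolding W_def .
qed

definition saturated :: "('v \<Rightarrow> 'b) \<Rightarrow> 'v set \<Rightarrow> 'v set \<Rightarrow> bool" where
  "saturated f V U \<longleftrightarrow> U \<subseteq> V \<and> (\<forall>u\<in>U. \<forall>v\<in>V. f u = f v \<longrightarrow> v \<in> U)"

text \<open>Take a largest union \<open>U\<close> of fibres with at most 2/3 of the points. If it
  has less than 1/3, a fibre outside \<open>U\<close> with less than 1/3 could be added, so every
  fibre outside has at least 1/3 and is itself balanced.\<close>

lemma balanced_saturated:
  assumes "finite V" "\<And>z. z \<in> V \<Longrightarrow> 3 * card {v\<in>V. f v = f z} \<le> 2 * card V"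
  shows "\<exists>U. saturated f V U \<and> card V \<le> 3 * card U \<and> 3 * card U \<le> 2 * card V"
proof -
  let ?P = "\<lambda>U. saturated f V U \<and> 3 * card U \<le> 2 * card V"
  have "?P {}" unfolding saturated_def by simp
  moreover have "card U < Suc (card V)" if "?P U" for U by (use that in linarith)
  ultimately obtain U where U: "?P U" and max: "\<And>U'. ?P U' \<Longrightarrow> card U' \<le> card U"
    using ex_has_greatest_nat[of ?P "{}" card "Suc (card V)"] by blast
  show ?thesis
  proof (cases "card V \<le> 3 * card U")
    case True
    then show ?thesis using U by blast
  next
    case False
    have finU: "finite U" "U \<subseteq> V" using U assms(1) finite_subset unfolding saturated_def by blast+
    have "U \<noteq> V" using False by auto
    then obtain z where z: "z \<in> V" "z \<notin> U" using finU by blast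
    define Z where "Z = {v\<in>V. f v = f z}"
    have satZ: "saturated f V Z" unfolding saturated_def Z_def by auto
    have "card V \<le> 3 * card Z"
    proof (rule ccontr)
      assume small: "\<not> card V \<le> 3 * card Z"
      have disj: "U \<inter> Z = {}" using U z unfolding saturated_def Z_def by auto
      have finZ: "finite Z" unfolding Z_def using assms(1) by simp
      have "z \<in> Z" unfolding Z_def using z by simp
      then have "card Z > 0" using finZ by (auto simp: card_gt_0_iff)
      moreover have card_Un: "card (U \<union> Z) = card U + card Z" using card_Un_disjoint finU(1) finZ disj by blast
      moreover have "saturated f V (U \<union> Z)" using U satZ unfolding saturated_def by blast
      then have "card (U \<union> Z) \<le> card U" using max[of "U \<union> Z"] card_Un small False by simp
      ultimately show False by simp
    qed
    then show ?thesis using satZ assms(2)[OF z(1)] unfolding Z_def by blast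
  qed
qed

lemma spanning_tree_if_hits_obstructions:
  assumes "n \<ge> 1" "M \<subseteq> RS_board n" and hits: "\<And>A. A \<in> obstructions n \<Longrightarrow> A \<inter> M \<noteq> {}"
  shows "\<exists>T\<in>rainbow_spanning_trees n. T \<subseteq> M"
proof (rule ccontr)
  let ?V = "{1..n}"
  assume "\<not> ?thesis"
  then obtain R f where R: "R \<subseteq> {1..n-1}" "n < card (f ` ?V) + card R"
    and f: "\<And>i u v. i \<in> R \<Longrightarrow> u \<in> ?V \<Longrightarrow> v \<in> ?V \<Longrightarrow> (i, {u, v}) \<in> M \<Longrightarrow> f u = (f v :: nat)"
    using rainbow_spanning_tree_or_obstruction[OF assms(2,1)] by metis
  have finR: "finite R" using R(1) finite_subset by blast
  have fV: "card (f ` ?V) \<le> n" using card_image_le[of ?V f] by simp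
  have cR: "card R \<le> n - 1" using card_mono[OF _ R(1)] by simp
  have missed: "(I \<times> P) \<inter> M = {}"
    if "I \<subseteq> R" "\<And>e. e \<in> P \<Longrightarrow> \<exists>u\<in>?V. \<exists>v\<in>?V. e = {u, v} \<and> f u \<noteq> f v" for I P
  proof -
    have "(i, e) \<notin> M" if ie: "i \<in> I" "e \<in> P" for i e
    proof -
      obtain u v where "u \<in> ?V" "v \<in> ?V" "e = {u, v}" "f u \<noteq> f v"
        using \<open>\<And>e. e \<in> P \<Longrightarrow> _\<close> ie(2) by blast
      then show ?thesis using f[of i u v] ie(1) \<open>I \<subseteq> R\<close> by blast
    qed
    then show ?thesis by blast
  qed
  have cut_missed: "(I \<times> cut_edges ?V U) \<inter> M = {}" if "I \<subseteq> R" "saturated f ?V U" for I U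
  proof (rule missed[OF that(1)])
    fix e assume "e \<in> cut_edges ?V U"
    then obtain u v where "u \<in> U" "v \<in> ?V - U" "e = {u, v}" unfolding cut_edges_def by auto
    then show "\<exists>u\<in>?V. \<exists>v\<in>?V. e = {u, v} \<and> f u \<noteq> f v" using that(2) unfolding saturated_def by blast
  qed
  have "\<exists>A\<in>obstructions n. A \<inter> M = {}"
  proof (cases "5 * card R \<le> n")
    case True
    define W0 where "W0 = {v\<in>?V. \<exists>u\<in>?V. u \<noteq> v \<and> f u = f v}"
    have "card W0 \<le> 2 * (n - card (f ` ?V))"
      using card_nonsingleton_fibres[of ?V f] unfolding W0_def by simp
    \<comment> \<open>There are at least n - card R + 1 parts; \<open>W0\<close> is then padded to
      the exact size.\<close>
    then have "card W0 \<le> 2 * card R - 2" using R(2) fV by linarith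
    moreover have "2 * card R - 2 \<le> card ?V" using True by simp
    moreover have "W0 \<subseteq> ?V" unfolding W0_def by auto
    ultimately obtain W where W: "W0 \<subseteq> W" "W \<subseteq> ?V" "card W = 2 * card R - 2"
      using exists_subset_between[of W0 "2 * card R - 2" ?V] by blast
    have "(R \<times> edges_leaving ?V W) \<inter> M = {}"
    proof (rule missed[OF order_refl])
      fix e assume e: "e \<in> edges_leaving ?V W"
      then have "e \<subseteq> ?V" "card e = 2" unfolding edges_leaving_def complete_edges_def by auto
      then obtain u v where uv: "e = {u, v}" "u \<noteq> v" "u \<in> ?V" "v \<in> ?V"
        unfolding card_2_iff by blast
      have "u \<notin> W \<or> v \<notin> W" using e uv unfolding edges_leaving_def complete_edges_def by auto
      then have "f u \<noteq> f v" using W(1) uv unfolding W0_def by force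
      then show "\<exists>u\<in>?V. \<exists>v\<in>?V. e = {u, v} \<and> f u \<noteq> f v" using uv by blast
    qed
    moreover have "card R \<ge> 1" using R(2) fV by linarith
    then have "R \<times> edges_leaving ?V W \<in> obstructions n"
      unfolding obstructions_def few_colours_def using True R(1) W(2,3) by blast
    ultimately show ?thesis by blast
  next
    case many: False
    show ?thesis
    proof (cases "\<exists>z\<in>?V. 3 * card {v\<in>?V. f v = f z} > 2 * card ?V")
      case True
      then obtain z where z: "z \<in> ?V" "3 * card {v\<in>?V. f v = f z} > 2 * n" by auto
      define U where "U = ?V - {v\<in>?V. f v = f z}"
      have "card U = n - card {v\<in>?V. f v = f z}"
        unfolding U_def by (subst card_Diff_subset) auto
      then have tn: "3 * card U < n" using z(2) assms(1) by linarith
      have finU: "finite U" unfolding U_def by simp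
      have "f ` ?V \<subseteq> insert (f z) (f ` U)" unfolding U_def by auto
      then have "card (f ` ?V) \<le> card (insert (f z) (f ` U))" using finU by (intro card_mono) auto
      also have "\<dots> \<le> Suc (card (f ` U))" using finU by (simp add: card_insert_if)
      also have "\<dots> \<le> Suc (card U)" using finU by (simp add: card_image_le)
      \<comment> \<open>The large part and at most \<open>card U\<close> others give at most
        \<open>card U + 1\<close> parts, so \<open>R\<close> has at least n - card U colours; as it
        has at most n - 1, \<open>U\<close> is nonempty.\<close>
      finally have cU: "n - card U \<le> card R" "card U \<ge> 1" using R(2) cR assms(1) by linarith+
      then obtain I where I: "I \<subseteq> R" "card I = n - card U"
        using obtain_subset_with_card_n by metis
      have "saturated f ?V U" unfolding saturated_def U_def by auto
      then have "(I \<times> cut_edges ?V U) \<inter> M = {}" using cut_missed I(1) by blast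
      moreover have "U \<subseteq> ?V" unfolding U_def by blast
      then have "I \<times> cut_edges ?V U \<in> small_cuts n (card U)"
        unfolding small_cuts_def using I R(1) by blast
      then have "I \<times> cut_edges ?V U \<in> obstructions n"
        unfolding obstructions_def using tn cU(2) by blast
      ultimately show ?thesis by blast
    next
      case False
      then have "\<exists>U. saturated f ?V U \<and> card ?V \<le> 3 * card U \<and> 3 * card U \<le> 2 * card ?V"
        by (intro balanced_saturated) (auto simp: not_less)
      then obtain U where U: "saturated f ?V U" "n \<le> 3 * card U" "3 * card U \<le> 2 * n" by auto
      have "U \<subseteq> ?V" using U(1) unfolding saturated_def by blast
      moreover have "n \<le> 5 * card R" using many by simp
      ultimately have "R \<times> cut_edges ?V U \<in> balanced_cuts n"
        unfolding balanced_cuts_def using U(2,3) R(1) by blast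
      then show ?thesis using cut_missed[OF order_refl U(1)] unfolding obstructions_def by blast
    qed
  qed
  then show False using hits by blast
qed

section \<open>The total danger of the obstructions\<close>

lemma card_edges_leaving:
  assumes "finite V" "W \<subseteq> V"
  shows "card (edges_leaving V W) = (card V choose 2) - (card W choose 2)"
proof -
  have finW: "finite W" using assms finite_subset by blast
  have "finite (complete_edges W)" unfolding complete_edges_def using finW by simp
  moreover have "complete_edges W \<subseteq> complete_edges V" using assms(2) unfolding complete_edges_def by blast
  ultimately show ?thesis
    unfolding edges_leaving_def using assms(1) finW by (simp add: card_Diff_subset card_complete_edges)
qed

lemma card_cut_edges:
  assumes "finite V" "U \<subseteq> V"
  shows "card (cut_edges V U) = card U * (card V - card U)"
proof -
  have "inj_on (\<lambda>(u, v). {u, v}) (U \<times> (V - U))"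
    by (rule inj_onI) (auto simp: doubleton_eq_iff)
  then show ?thesis
    unfolding cut_edges_def using assms finite_subset[OF assms(2,1)]
    by (simp add: card_image card_cartesian_product card_Diff_subset)
qed

lemma cut_edges_subset: "U \<subseteq> V \<Longrightarrow> cut_edges V U \<subseteq> complete_edges V"
  unfolding cut_edges_def complete_edges_def by (auto simp: card_2_iff)

lemma obstruction_subset_board:
  assumes "A \<in> obstructions n"
  shows "A \<subseteq> RS_board n"
proof -
  have "\<exists>I P. A = I \<times> P \<and> I \<subseteq> {1..n-1} \<and> P \<subseteq> complete_edges {1..n}"
    using assms unfolding obstructions_def
  proof (elim UnE UN_E)
    fix k assume "A \<in> few_colours n k"
    then obtain I W where "A = I \<times> edges_leaving {1..n} W" "I \<subseteq> {1..n-1}"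
      unfolding few_colours_def by auto
    then show ?thesis
      by (intro exI[of _ I] exI[of _ "edges_leaving {1..n} W"]) (simp add: edges_leaving_def Diff_subset)
  next
    assume "A \<in> balanced_cuts n"
    then obtain I U where "A = I \<times> cut_edges {1..n} U" "I \<subseteq> {1..n-1}" "U \<subseteq> {1..n}"
      unfolding balanced_cuts_def by auto
    then show ?thesis using cut_edges_subset[of U "{1..n}"] by (intro exI[of _ I] exI[of _ "cut_edges {1..n} U"]) simp
  next
    fix t assume "A \<in> small_cuts n t"
    then obtain I U where "A = I \<times> cut_edges {1..n} U" "I \<subseteq> {1..n-1}" "U \<subseteq> {1..n}"
      unfolding small_cuts_def by auto
    then show ?thesis using cut_edges_subset[of U "{1..n}"] by (intro exI[of _ I] exI[of _ "cut_edges {1..n} U"]) simp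
  qed
  then show ?thesis unfolding RS_board_def by blast
qed

lemma finite_obstructions: "finite (obstructions n)"
proof -
  have "obstructions n \<subseteq> Pow (RS_board n)" using obstruction_subset_board by blast
  then show ?thesis using finite_RS_board by (rule finite_subset[OF _ iffD2[OF finite_Pow_iff]])
qed

section \<open>Weights of the three kinds of obstruction\<close>

lemma binomial_le_power: "n choose k \<le> n ^ k"
  by (cases "k \<le> n") (simp_all add: binomial_le_pow binomial_eq_0)

definition critical_bias :: "nat \<Rightarrow> real" where
  "critical_bias n = ln 2 / 8 * real n ^ 2 / ln (real n)"

text \<open>The factor \<open>ln 2\<close> in \<open>critical_bias\<close> cancels the base 2 of
  \<open>danger\<close>, which leaves n to the power -8 * card A / n^2.\<close>

lemma danger_le_powr:
  assumes "n \<ge> 2" "r * real n ^ 2 \<le> 8 * real (card A)"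
  shows "danger (critical_bias n) {} A \<le> real n powr (- r)"
proof -
  have "danger (critical_bias n) {} A = exp (- real (card A) * 8 * ln (real n) / real n ^ 2)"
    unfolding danger_def critical_bias_def powr_def using assms(1) by (simp add: field_simps)
  also have "\<dots> \<le> exp (- r * ln (real n))"
  proof -
    have "r * real n ^ 2 * ln (real n) \<le> 8 * real (card A) * ln (real n)"
      using assms by (intro mult_right_mono) auto
    then show ?thesis using assms(1) by (simp add: field_simps)
  qed
  finally show ?thesis unfolding powr_def using assms(1) by simp
qed

text \<open>There are at most n^k * n^(2k-2) such sets. Each has at least 3/8 * k * n^2 elements,
  hence danger at most n^(-3k).\<close>

lemma sum_few_colours:
  assumes "n \<ge> 12" "1 \<le> k" "5 * k \<le> n"
  shows "(\<Sum>A\<in>few_colours n k. danger (critical_bias n) {} A) \<le> real n powr (-2)"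
proof -
  have "card (few_colours n k) \<le>
      card ({I. I \<subseteq> {1..n-1} \<and> card I = k} \<times> {W. W \<subseteq> {1..n} \<and> card W = 2 * k - 2})"
    unfolding few_colours_def by (intro card_image_le) auto
  also have "\<dots> = ((n - 1) choose k) * (n choose (2 * k - 2))"
    by (simp add: card_cartesian_product n_subsets)
  also have "\<dots> \<le> n ^ k * n ^ (2 * k - 2)"
    using binomial_le_power[of "n - 1" k] power_mono[of "n - 1" n k]
    by (intro mult_mono binomial_le_power) auto
  finally have "real (card (few_colours n k)) \<le> real (n ^ (k + (2 * k - 2)))"
    by (simp only: of_nat_le_iff power_add)
  also have "\<dots> = real n powr (3 * real k - 2)"
    using assms by (simp add: powr_realpow[symmetric] of_nat_diff)
  finally have count: "real (card (few_colours n k)) \<le> real n powr (3 * real k - 2)" .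
  have "danger (critical_bias n) {} A \<le> real n powr (- (3 * real k))" if "A \<in> few_colours n k" for A
  proof (rule danger_le_powr)
    from that obtain I W where A: "A = I \<times> edges_leaving {1..n} W" "card I = k"
      "W \<subseteq> {1..n}" "card W = 2 * k - 2"
      unfolding few_colours_def by auto
    have "real ((2 * k - 2) choose 2) \<le> real ((2 * k) ^ 2) / 2"
    proof -
      have "((2 * k - 2) choose 2) * 2 \<le> (2 * k - 2) * (2 * k - 2)"
        using div_mult_mod_eq[of "(2 * k - 2) * (2 * k - 2 - 1)" 2] unfolding choose_two
        by (metis div_times_less_eq_dividend mult_le_mono2 diff_le_self order_trans)
      also have "\<dots> \<le> (2 * k) ^ 2" unfolding power2_eq_square by (intro mult_le_mono) auto
      finally show ?thesis by linarith
    qed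
    moreover have "real (n choose 2) = real n * (real n - 1) / 2"
      using assms(1) by (simp add: choose_two real_of_nat_div of_nat_diff)
    moreover have "card (edges_leaving {1..n} W) = (n choose 2) - ((2 * k - 2) choose 2)"
      using card_edges_leaving[OF _ A(3)] A(4) by simp
    then have "real (n choose 2) - real ((2 * k - 2) choose 2) \<le> real (card (edges_leaving {1..n} W))"
      by linarith
    ultimately have "real n * (real n - 1) - 4 * real k ^ 2 \<le> 2 * real (card (edges_leaving {1..n} W))"
      by (simp add: power2_eq_square)
    moreover have "25 * real k ^ 2 \<le> real n ^ 2"
      using power_mono[of "5 * real k" "real n" 2] assms(3) by (simp add: power_mult_distrib)
    moreover have "12 * real n \<le> real n ^ 2"
      using assms(1) unfolding power2_eq_square by (intro mult_right_mono) auto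
    \<comment> \<open>The bounds on \<open>k\<close> and \<open>n\<close> enter through 1 - 1/12 -
      4/25 > 3/4.\<close>
    ultimately have "3 * real n ^ 2 \<le> 8 * real (card (edges_leaving {1..n} W))"
      by (simp add: power2_eq_square algebra_simps)
    then have "real k * (3 * real n ^ 2) \<le> real k * (8 * real (card (edges_leaving {1..n} W)))"
      by (intro mult_left_mono) auto
    then show "3 * real k * real n ^ 2 \<le> 8 * real (card A)"
      unfolding A(1) card_cartesian_product A(2) by (simp add: mult_ac)
  qed (use assms(1) in simp)
  then have "(\<Sum>A\<in>few_colours n k. danger (critical_bias n) {} A) \<le>
      real (card (few_colours n k)) * real n powr (- (3 * real k))"
    by (rule sum_bounded_above)
  also have "\<dots> \<le> real n powr (3 * real k - 2) * real n powr (- (3 * real k))"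
    using count by (rule mult_right_mono) simp
  also have "\<dots> = real n powr (-2)" by (simp flip: powr_add)
  finally show ?thesis .
qed

text \<open>Each set has at least n/5 * 2n^2/9 elements. The resulting danger decays faster than any
  exponential, so the crude count 4^n is harmless.\<close>

lemma sum_balanced_cuts:
  assumes "n \<ge> 2"
  shows "(\<Sum>A\<in>balanced_cuts n. danger (critical_bias n) {} A) \<le> 4 ^ n * real n powr (- (16 / 45 * real n))"
proof -
  have "card (balanced_cuts n) \<le> card ({I. I \<subseteq> {1..n-1} \<and> n \<le> 5 * card I} \<times>
      {U. U \<subseteq> {1..n} \<and> n \<le> 3 * card U \<and> 3 * card U \<le> 2 * n})"
    unfolding balanced_cuts_def by (intro card_image_le) auto
  also have "\<dots> \<le> card (Pow {1..n} \<times> Pow {1..n})"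
  proof (rule card_mono)
    have "{1..n-1} \<subseteq> {1..n}" by auto
    then show "{I. I \<subseteq> {1..n-1} \<and> n \<le> 5 * card I} \<times>
        {U. U \<subseteq> {1..n} \<and> n \<le> 3 * card U \<and> 3 * card U \<le> 2 * n} \<subseteq> Pow {1..n} \<times> Pow {1..n}"
      by blast
  qed simp
  also have "\<dots> = 4 ^ n" by (simp add: card_cartesian_product card_Pow flip: power_mult_distrib)
  finally have count: "real (card (balanced_cuts n)) \<le> 4 ^ n"
    by (metis of_nat_le_iff of_nat_numeral of_nat_power)
  have "danger (critical_bias n) {} A \<le> real n powr (- (16 / 45 * real n))" if "A \<in> balanced_cuts n" for A
  proof (rule danger_le_powr)
    from that obtain I U where A: "A = I \<times> cut_edges {1..n} U" "n \<le> 5 * card I"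
      "U \<subseteq> {1..n}" "n \<le> 3 * card U" "3 * card U \<le> 2 * n"
      unfolding balanced_cuts_def by auto
    define u where "u = real (card U)"
    have "real (card (cut_edges {1..n} U)) = u * (real n - u)"
      using card_cut_edges[OF _ A(3)] A(5) unfolding u_def by (simp add: of_nat_diff)
    \<comment> \<open>The product equals 9u(n - u) - 2n^2.\<close>
    moreover have "0 \<le> (3 * u - real n) * (2 * real n - 3 * u)"
      using A(4,5) unfolding u_def by (intro mult_nonneg_nonneg) linarith+
    ultimately have c: "2 / 9 * real n ^ 2 \<le> real (card (cut_edges {1..n} U))"
      by (simp add: power2_eq_square algebra_simps)
    have "real n / 5 * (2 / 9 * real n ^ 2) \<le> real (card I) * real (card (cut_edges {1..n} U))"
      using A(2) c by (intro mult_mono) auto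
    then show "16 / 45 * real n * real n ^ 2 \<le> 8 * real (card A)"
      unfolding A(1) card_cartesian_product by simp
  qed (use assms in simp)
  then have "(\<Sum>A\<in>balanced_cuts n. danger (critical_bias n) {} A) \<le>
      real (card (balanced_cuts n)) * real n powr (- (16 / 45 * real n))"
    by (rule sum_bounded_above)
  also have "\<dots> \<le> 4 ^ n * real n powr (- (16 / 45 * real n))"
    using count by (rule mult_right_mono) simp
  finally show ?thesis .
qed

text \<open>The count is at most n^(2t). Each set has t(n - t)^2 elements, at least 4/9 * t * n^2,
  and 7/2 is a value below 8 * 4/9 that exceeds the 3 needed to sum over up to n values of
  \<open>t\<close>.\<close>

lemma sum_small_cuts:
  assumes "n \<ge> 2" "1 \<le> t" "3 * t < n"
  shows "(\<Sum>A\<in>small_cuts n t. danger (critical_bias n) {} A) \<le> real n powr (-3/2)"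
proof -
  have "card (small_cuts n t) \<le>
      card ({I. I \<subseteq> {1..n-1} \<and> card I = n - t} \<times> {U. U \<subseteq> {1..n} \<and> card U = t})"
    unfolding small_cuts_def by (intro card_image_le) auto
  also have "\<dots> = ((n - 1) choose (n - t)) * (n choose t)"
    by (simp add: card_cartesian_product n_subsets)
  \<comment> \<open>Counting the t - 1 omitted colours instead gives a power of n with exponent of
    order t.\<close>
  also have "(n - 1) choose (n - t) = (n - 1) choose (t - 1)"
    using assms binomial_symmetric[of "n - t" "n - 1"] by (simp add: diff_diff_eq2)
  also have "((n - 1) choose (t - 1)) * (n choose t) \<le> n ^ t * n ^ t"
  proof (intro mult_mono binomial_le_power)
    have "(n - 1) choose (t - 1) \<le> (n - 1) ^ (t - 1)" by (rule binomial_le_power)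
    also have "\<dots> \<le> n ^ (t - 1)" by (intro power_mono) auto
    also have "\<dots> \<le> n ^ t" using assms(1) by (intro power_increasing) auto
    finally show "(n - 1) choose (t - 1) \<le> n ^ t" .
  qed auto
  finally have "real (card (small_cuts n t)) \<le> real (n ^ (t + t))"
    by (simp only: of_nat_le_iff power_add)
  also have "\<dots> = real n powr (2 * real t)"
    using assms by (simp add: powr_realpow[symmetric])
  finally have count: "real (card (small_cuts n t)) \<le> real n powr (2 * real t)" .
  have "danger (critical_bias n) {} A \<le> real n powr (- (7 / 2 * real t))" if "A \<in> small_cuts n t" for A
  proof (rule danger_le_powr)
    from that obtain I U where A: "A = I \<times> cut_edges {1..n} U" "card I = n - t"
      "U \<subseteq> {1..n}" "card U = t"
      unfolding small_cuts_def by auto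
    have "real (card A) = (real n - real t) ^ 2 * real t"
      unfolding A(1) card_cartesian_product A(2)
      using card_cut_edges[OF _ A(3)] A(4) assms(3) by (simp add: of_nat_diff power2_eq_square)
    moreover have "(2 / 3 * real n) ^ 2 \<le> (real n - real t) ^ 2"
      using assms(3) by (intro power_mono) auto
    then have "(2 / 3 * real n) ^ 2 * real t \<le> (real n - real t) ^ 2 * real t"
      by (intro mult_right_mono) auto
    moreover have "7 / 2 * real t * real n ^ 2 \<le> 8 * ((2 / 3 * real n) ^ 2 * real t)"
      by (simp add: power_mult_distrib power_divide)
    ultimately show "7 / 2 * real t * real n ^ 2 \<le> 8 * real (card A)" by linarith
  qed (use assms(1) in simp)
  then have "(\<Sum>A\<in>small_cuts n t. danger (critical_bias n) {} A) \<le>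
      real (card (small_cuts n t)) * real n powr (- (7 / 2 * real t))"
    by (rule sum_bounded_above)
  also have "\<dots> \<le> real n powr (2 * real t) * real n powr (- (7 / 2 * real t))"
    using count by (rule mult_right_mono) simp
  also have "\<dots> = real n powr (- 3 / 2 * real t)" by (simp flip: powr_add)
  also have "\<dots> \<le> real n powr (-3/2)" using assms(1,2) by (intro powr_mono) auto
  finally show ?thesis .
qed

section \<open>Union bound over all obstructions\<close>

lemma sum_Un_le:
  assumes "finite A" "finite B" "\<And>x. g x \<ge> (0 :: real)"
  shows "sum g (A \<union> B) \<le> sum g A + sum g B"
  using sum.union_inter[OF assms(1,2), of g] sum_nonneg[of "A \<inter> B" g] assms(3) by simp

lemma sum_UN_le:
  assumes "finite K" "\<And>k. k \<in> K \<Longrightarrow> finite (A k)" "\<And>x. g x \<ge> (0 :: real)"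
  shows "sum g (\<Union>k\<in>K. A k) \<le> (\<Sum>k\<in>K. sum g (A k))"
  using assms(1,2)
proof (induction K rule: finite_induct)
  case (insert k K)
  have "sum g (A k \<union> (\<Union>k\<in>K. A k)) \<le> sum g (A k) + sum g (\<Union>k\<in>K. A k)"
    using insert assms(3) by (intro sum_Un_le) auto
  then show ?case using insert by force
qed simp

lemma sum_obstructions:
  assumes "n \<ge> 12"
  shows "(\<Sum>A\<in>obstructions n. danger (critical_bias n) {} A) \<le>
    real n * real n powr (-2) + (4 ^ n * real n powr (- (16 / 45 * real n)) + real n * real n powr (-3/2))"
proof -
  let ?g = "danger (critical_bias n) {}"
  let ?K = "{k. 1 \<le> k \<and> 5 * k \<le> n}" and ?T = "{t. 1 \<le> t \<and> 3 * t < n}"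
  have sub: "?K \<subseteq> {1..n}" "?T \<subseteq> {1..n}" by auto
  then have fin: "finite ?K" "finite ?T" using finite_subset by blast+
  have card: "card ?K \<le> n" "card ?T \<le> n" using card_mono[OF _ sub(1)] card_mono[OF _ sub(2)] by simp_all
  have g: "?g A \<ge> 0" for A unfolding danger_def by simp
  have finF: "finite (few_colours n k)" "finite (balanced_cuts n)" "finite (small_cuts n k)" for k
    unfolding few_colours_def balanced_cuts_def small_cuts_def by (auto intro!: finite_imageI)
  have "sum ?g (\<Union>k\<in>?K. few_colours n k) \<le> (\<Sum>k\<in>?K. sum ?g (few_colours n k))"
    using fin finF g by (intro sum_UN_le) auto
  also have "\<dots> \<le> real (card ?K) * real n powr (-2)"
    using sum_few_colours[OF assms] by (intro sum_bounded_above) auto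
  also have "\<dots> \<le> real n * real n powr (-2)" using card by (intro mult_right_mono) auto
  finally have few: "sum ?g (\<Union>k\<in>?K. few_colours n k) \<le> real n * real n powr (-2)" .
  have "sum ?g (\<Union>t\<in>?T. small_cuts n t) \<le> (\<Sum>t\<in>?T. sum ?g (small_cuts n t))"
    using fin finF g by (intro sum_UN_le) auto
  also have "\<dots> \<le> real (card ?T) * real n powr (-3/2)"
    using sum_small_cuts[of n] assms by (intro sum_bounded_above) auto
  also have "\<dots> \<le> real n * real n powr (-3/2)" using card by (intro mult_right_mono) auto
  finally have small: "sum ?g (\<Union>t\<in>?T. small_cuts n t) \<le> real n * real n powr (-3/2)" .
  have "sum ?g (obstructions n) \<le> sum ?g (\<Union>k\<in>?K. few_colours n k) +
      sum ?g (balanced_cuts n \<union> (\<Union>t\<in>?T. small_cuts n t))"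
    unfolding obstructions_def using fin finF g by (intro sum_Un_le) auto
  also have "sum ?g (balanced_cuts n \<union> (\<Union>t\<in>?T. small_cuts n t)) \<le>
      sum ?g (balanced_cuts n) + sum ?g (\<Union>t\<in>?T. small_cuts n t)"
    using fin finF g by (intro sum_Un_le) auto
  finally show ?thesis using few small sum_balanced_cuts[of n] assms by linarith
qed

text \<open>The initial potential is at most n^(-1) + 4^n * n^(-16n/45) + n^(-1/2), which tends to
  0.\<close>

lemma maker_wins_below_critical_bias:
  "\<forall>\<^sub>F n in sequentially. \<forall>b. real b \<le> critical_bias n \<longrightarrow>
     maker_wins (RS_board n) (rainbow_spanning_trees n) b"
proof -
  have "\<forall>\<^sub>F n in sequentially. real n * real n powr (-2) +
      (4 ^ n * real n powr (- (16 / 45 * real n)) + real n * real n powr (-3/2)) < 1"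
    by real_asymp
  with eventually_ge_at_top[of 12] show ?thesis
  proof eventually_elim
    case (elim n)
    show ?case
    proof (intro allI impI)
      fix b :: nat assume b: "real b \<le> critical_bias n"
      show "maker_wins (RS_board n) (rainbow_spanning_trees n) b"
        unfolding maker_wins_def
      proof (rule maker_wins_from_potential[OF finite_RS_board finite_obstructions _ b])
        show "critical_bias n > 0" unfolding critical_bias_def using elim(1) by simp
        show "(\<Sum>A\<in>unhit (obstructions n) {}. danger (critical_bias n) {} A) < 1"
          using sum_obstructions[OF elim(1)] elim(2) unfolding unhit_def by simp
        show "\<exists>W\<in>rainbow_spanning_trees n. W \<subseteq> M"
          if "M \<subseteq> RS_board n" "\<And>A. A \<in> obstructions n \<Longrightarrow> A \<inter> M \<noteq> {}" for M
          using spanning_tree_if_hits_obstructions elim(1) that by simp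
      qed (use obstruction_subset_board in auto)
    qed
  qed
qed

section \<open>Combining the two bounds\<close>

theorem theorem1p7:
  fixes \<epsilon> :: real
  assumes "\<epsilon> > 0"
  shows "\<forall>\<^sub>F n in sequentially.
           (ln 2 / 8 - \<epsilon>) * real n ^ 2 / ln (real n) \<le> real (RS_threshold n) \<and>
           real (RS_threshold n) \<le> (1 + \<epsilon>) * real n ^ 2 / ln (real n)"
  using maker_wins_below_critical_bias RS_threshold_upper eventually_ge_at_top[of 2]
proof eventually_elim
  case (elim n)
  have q: "real n ^ 2 / ln (real n) \<ge> 0" using elim(3) by simp
  have "(ln 2 / 8 - \<epsilon>) * real n ^ 2 / ln (real n) \<le> critical_bias n"
    using mult_right_mono[OF _ q, of "ln 2 / 8 - \<epsilon>" "ln 2 / 8"] assms unfolding critical_bias_def by simp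
  \<comment> \<open>Maker wins at every bias up to \<open>critical_bias n\<close> but not at the
    threshold.\<close>
  also have "\<dots> \<le> real (RS_threshold n)" using elim(1,2) by (meson linear)
  finally have "(ln 2 / 8 - \<epsilon>) * real n ^ 2 / ln (real n) \<le> real (RS_threshold n)" .
  moreover have "real n ^ 2 / ln (real n) \<le> (1 + \<epsilon>) * real n ^ 2 / ln (real n)"
    using mult_right_mono[OF _ q, of 1 "1 + \<epsilon>"] assms by simp
  ultimately show ?case using elim(2) by linarith
qed

end
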